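(* Let $$\alpha=\frac{2\rho}{-1+\rho+\sqrt{(1-\rho)(1+3\rho)}}.$$ In the fluid polling system with $c>d$, started with $x(0)=x_0>0$ and $y(0)=0$, it is optimal (i.e. it minimizes the total cost $\int_0^T (c\,x(t)+d\,y(t))\,dt$ over all routing policies) to route all incoming fluid to the idle queue at time $t$ if $y(t)<\alpha x(t)$, and all incoming fluid to the busy queue otherwise.
   Context: Fluid polling system: let $0<\lambda<\mu$, $\rho=\lambda/\mu$. Fluid arrives deterministically at rate $\lambda$ and is routed to one of two queues. A single server empties the queue it is at (the busy queue; the other is the idle queue) at rate $\mu$ until it is empty, then instantaneously switches to the other queue. Let $x(t)$ and $y(t)$ be the amounts of fluid in the busy and idle queue at time $t$. At time $0$ the server has just switched to queue 1, with $x(0)=x_0>0$, $y(0)=0$. The total content $x(t)+y(t)$ decreases at rate $\mu-\lambda$ until it hits $0$ at time $T=x_0/(\mu-\lambda)$, irrespective of the routing; after $T$ the system is kept empty. A routing policy is a (measurable) function $r$ with $0\le r(t)\le\lambda$: at time $t$ fluid is routed at rate $r(t)$ to the idle queue and at rate $\lambda-r(t)$ to the busy queue. It determines switching times $t_0=0\le t_1\le t_2\le\cdots$ and levels $x_k$ recursively by $$t_{k+1}=\min\Big\{t\ge t_k:\ x_k+\int_{t_k}^t(\lambda-r(u))\,du-\mu(t-t_k)=0\Big\},\qquad x_{k+1}=\int_{t_k}^{t_{k+1}}r(u)\,du,$$ and for $t_k\le t<t_{k+1}$: $x(t)=x_k+\int_{t_k}^t(\lambda-r(u))\,du-\mu(t-t_k)$,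 $y(t)=\int_{t_k}^t r(u)\,du$ (at time $t_{k+1}$ the roles of the two queues are interchanged). The cost rates are $c$ per unit of fluid in the busy queue and $d$ per unit of fluid in the idle queue. *)

theory Defs
  imports "HOL-Analysis.Analysis"
begin

text \<open>
  Parameters throughout: arrival rate \<open>lam\<close>, service rate \<open>mu\<close>, initial content \<open>x0\<close> of the
  busy queue, and the rate \<open>r t\<close> at which fluid is routed to the idle queue at time \<open>t\<close>.
\<close>

definition admissible_policy :: "real \<Rightarrow> (real \<Rightarrow> real) \<Rightarrow> bool" where
  "admissible_policy lam r \<longleftrightarrow>
     r \<in> borel_measurable (lebesgue_on {0..}) \<and> (\<forall>t\<ge>0. 0 \<le> r t \<and> r t \<le> lam)"

definition empty_time :: "real \<Rightarrow> real \<Rightarrow> real \<Rightarrow> real" where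
  "empty_time lam mu x0 = x0 / (mu - lam)"

text \<open>
  The pair \<open>(t\<^sub>k, x\<^sub>k)\<close> of the \<open>k\<close>-th switching time and the level of the newly busy queue at that
  time. For \<open>0 < lam < mu\<close> and an admissible policy the minimum is attained, since the expression
  set to zero is continuous in \<open>t\<close>, nonnegative at \<open>t\<^sub>k\<close>, and tends to minus infinity.
\<close>

primrec switching :: "real \<Rightarrow> real \<Rightarrow> real \<Rightarrow> (real \<Rightarrow> real) \<Rightarrow> nat \<Rightarrow> real \<times> real" where
  "switching lam mu x0 r 0 = (0, x0)"
| "switching lam mu x0 r (Suc k) =
     (let tk = fst (switching lam mu x0 r k);
          xk = snd (switching lam mu x0 r k);
          tk' = (LEAST t. tk \<le> t \<and> xk + integral {tk..t} (\<lambda>u. lam - r u) - mu * (t - tk) = 0)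
      in (tk', integral {tk..tk'} r))"

definition switch_time :: "real \<Rightarrow> real \<Rightarrow> real \<Rightarrow> (real \<Rightarrow> real) \<Rightarrow> nat \<Rightarrow> real" where
  "switch_time lam mu x0 r k = fst (switching lam mu x0 r k)"

definition switch_level :: "real \<Rightarrow> real \<Rightarrow> real \<Rightarrow> (real \<Rightarrow> real) \<Rightarrow> nat \<Rightarrow> real" where
  "switch_level lam mu x0 r k = snd (switching lam mu x0 r k)"

text \<open>
  The index \<open>k\<close> with \<open>t\<^sub>k \<le> t < t\<^sub>k\<^sub>+\<^sub>1\<close>. It is unique because the switching times are nondecreasing,
  and it exists for every \<open>0 \<le> t < T\<close> because they converge to the emptying time \<open>T\<close>.
\<close>

definition stage :: "real \<Rightarrow> real \<Rightarrow> real \<Rightarrow> (real \<Rightarrow> real) \<Rightarrow> real \<Rightarrow> nat" where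
  "stage lam mu x0 r t =
     (THE k. switch_time lam mu x0 r k \<le> t \<and> t < switch_time lam mu x0 r (Suc k))"

definition busy :: "real \<Rightarrow> real \<Rightarrow> real \<Rightarrow> (real \<Rightarrow> real) \<Rightarrow> real \<Rightarrow> real" where
  "busy lam mu x0 r t =
     (if t < empty_time lam mu x0 then
        (let k = stage lam mu x0 r t; tk = switch_time lam mu x0 r k
         in switch_level lam mu x0 r k + integral {tk..t} (\<lambda>u. lam - r u) - mu * (t - tk))
      else 0)"

definition idle :: "real \<Rightarrow> real \<Rightarrow> real \<Rightarrow> (real \<Rightarrow> real) \<Rightarrow> real \<Rightarrow> real" where
  "idle lam mu x0 r t =
     (if t < empty_time lam mu x0 then
        integral {switch_time lam mu x0 r (stage lam mu x0 r t)..t} r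
      else 0)"

definition total_cost ::
  "real \<Rightarrow> real \<Rightarrow> real \<Rightarrow> real \<Rightarrow> real \<Rightarrow> (real \<Rightarrow> real) \<Rightarrow> real" where
  "total_cost lam mu x0 c d r =
     integral {0..empty_time lam mu x0} (\<lambda>t. c * busy lam mu x0 r t + d * idle lam mu x0 r t)"

definition optimal_policy ::
  "real \<Rightarrow> real \<Rightarrow> real \<Rightarrow> real \<Rightarrow> real \<Rightarrow> (real \<Rightarrow> real) \<Rightarrow> bool" where
  "optimal_policy lam mu x0 c d r \<longleftrightarrow>
     admissible_policy lam r \<and>
     (\<forall>r'. admissible_policy lam r' \<longrightarrow> total_cost lam mu x0 c d r \<le> total_cost lam mu x0 c d r')"

text \<open>
  The feedback rule with threshold \<open>a\<close> is a condition on \<open>r\<close>, as the state it refers to is the one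
  generated by \<open>r\<close> itself. Values of \<open>r\<close> from the emptying time onwards are irrelevant.
\<close>

definition follows_threshold_rule ::
  "real \<Rightarrow> real \<Rightarrow> real \<Rightarrow> real \<Rightarrow> (real \<Rightarrow> real) \<Rightarrow> bool" where
  "follows_threshold_rule lam mu x0 a r \<longleftrightarrow>
     (\<forall>t. 0 \<le> t \<and> t < empty_time lam mu x0 \<longrightarrow>
        r t = (if idle lam mu x0 r t < a * busy lam mu x0 r t then lam else 0))"

definition threshold :: "real \<Rightarrow> real" where
  "threshold rho = 2 * rho / (- 1 + rho + sqrt ((1 - rho) * (1 + 3 * rho)))"

end

theory Submission
  imports Defs
begin

text \<open>
  Since \<open>x + y\<close> does not depend on the routing, minimizing the cost amounts to maximizing \<open>\<integral> y\<close>.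
  On a stage that starts with content \<open>x\<close> and ends with content \<open>z\<close>, \<open>y\<close> is at most \<open>lam\<close> times
  the elapsed time and at most \<open>z\<close>, so the stage contributes at most
  \<open>z (x - z) / (mu - lam) - z\<^sup>2 / (2 lam)\<close>. The value function of the resulting dynamic program is
  \<open>\<theta> x\<^sup>2 / (2 (mu - lam))\<close>, where \<open>0 < \<theta> < 1\<close> solves \<open>lam (1 - \<theta>)\<^sup>2 = (mu - lam) \<theta>\<close>: completing the
  square bounds the contribution by \<open>\<theta> (x\<^sup>2 - z\<^sup>2) / (2 (mu - lam))\<close>, with equality for \<open>z = \<theta> x\<close>.
  The threshold satisfies \<open>\<alpha> = 1 / (1 - \<theta>)\<close>, and the threshold rule attains equality in both bounds
  on every stage.
\<close>

section \<open>The constant \<open>\<theta>\<close> and elementary integrals\<close>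

text \<open>Divided by \<open>mu\<close>, the equation reads
  \<open>\<rho> * \<theta>^2 - (1 + \<rho>) * \<theta> + \<rho> = 0\<close>. Its discriminant is the
  radicand in \<open>threshold\<close>, and \<open>\<theta>\<close> is the smaller root. The bounds
  \<open>1 - \<rho> < S < 1 + \<rho>\<close> say exactly that
  \<open>0 < \<theta> < 1\<close>.\<close>

lemma threshold_contraction:
  fixes lam mu :: real
  assumes "0 < lam" "lam < mu"
  obtains \<theta> where "0 < \<theta>" "\<theta> < 1" "lam * (1 - \<theta>)\<^sup>2 = (mu - lam) * \<theta>"
    "threshold (lam / mu) = 1 / (1 - \<theta>)"
proof -
  define \<rho> where "\<rho> = lam / mu"
  have \<rho>: "0 < \<rho>" "\<rho> < 1" "lam = \<rho> * mu" using assms by (auto simp: \<rho>_def)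
  define S where "S = sqrt ((1 - \<rho>) * (1 + 3 * \<rho>))"
  have S2: "S\<^sup>2 = (1 - \<rho>) * (1 + 3 * \<rho>)" using \<rho> by (simp add: S_def)
  have "(1 - \<rho>)\<^sup>2 < S\<^sup>2" unfolding S2 using \<rho> mult_pos_pos[of \<rho> "1-\<rho>"] by (simp add: power2_eq_square algebra_simps)
  then have S1: "1 - \<rho> < S" by (rule power2_less_imp_less) (use \<rho> in \<open>auto simp: S_def\<close>)
  have "S\<^sup>2 < (1 + \<rho>)\<^sup>2" unfolding S2 using \<rho> by (simp add: power2_eq_square algebra_simps)
  then have S3: "S < 1 + \<rho>" by (rule power2_less_imp_less) (use \<rho> in auto)
  define \<theta> where "\<theta> = (1 + \<rho> - S) / (2 * \<rho>)"
  have \<theta>: "2 * \<rho> * \<theta> = 1 + \<rho> - S" using \<rho> by (simp add: \<theta>_def)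
  have "0 < \<theta>" using S3 \<rho> by (simp add: \<theta>_def)
  moreover have "\<theta> < 1" using S1 \<rho> by (simp add: \<theta>_def)
  moreover have "lam * (1 - \<theta>)\<^sup>2 = (mu - lam) * \<theta>"
  proof -
    \<comment> \<open>The factor \<open>4 * \<rho>\<close> lets \<open>\<theta>\<close> occur only
      as \<open>2 * \<rho> * \<theta>\<close>, which is linear in \<open>S\<close>;
      \<open>S2\<close> then removes the square.\<close>
    have "4 * \<rho> * (\<rho> * (1 - \<theta>)\<^sup>2) = (2 * \<rho> - 2 * \<rho> * \<theta>)\<^sup>2" by (simp add: power2_eq_square algebra_simps)
    also have "\<dots> = (\<rho> - 1 + S)\<^sup>2" unfolding \<theta> by (simp add: power2_eq_square algebra_simps)
    also have "\<dots> = 2 * (1 - \<rho>) * (2 * \<rho> * \<theta>)"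
      unfolding \<theta> using S2 by (simp add: power2_eq_square algebra_simps)
    finally have "4 * \<rho> * (\<rho> * (1 - \<theta>)\<^sup>2) = 4 * \<rho> * ((1 - \<rho>) * \<theta>)"
      by (simp only: mult_ac)
    then have eq: "\<rho> * (1 - \<theta>)\<^sup>2 = (1 - \<rho>) * \<theta>" using \<rho> by simp
    have "lam * (1 - \<theta>)\<^sup>2 = mu * (\<rho> * (1 - \<theta>)\<^sup>2)" by (simp add: \<rho>(3))
    also have "\<dots> = (mu - lam) * \<theta>" unfolding eq by (simp add: \<rho>(3) algebra_simps)
    finally show ?thesis .
  qed
  moreover have "threshold (lam / mu) = 1 / (1 - \<theta>)"
  proof -
    have "2 * \<rho> * (1 - \<theta>) = - 1 + \<rho> + S" using \<theta> by (simp add: algebra_simps)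
    then have "threshold \<rho> = 2 * \<rho> / (2 * \<rho> * (1 - \<theta>))" by (simp add: threshold_def S_def)
    also have "\<dots> = 1 / (1 - \<theta>)" using \<rho> by simp
    finally show ?thesis by (simp add: \<rho>_def)
  qed
  ultimately show thesis by (rule that)
qed

text \<open>On the left, \<open>z^2\<close> has coefficient
  \<open>1 / m + 1 / (2 * lam) - \<theta> / (2 * m)\<close>. The equation for
  \<open>\<theta>\<close> turns this into \<open>1 / (2 * m * \<theta>)\<close>, precisely what
  makes the quadratic form a perfect square. Here \<open>m\<close> stands for
  \<open>mu - lam\<close>.\<close>

lemma stage_reward_identity:
  fixes x z lam m \<theta> :: real
  assumes "0 < lam" "0 < m" "0 < \<theta>" "lam * (1 - \<theta>)\<^sup>2 = m * \<theta>"
  shows "\<theta> / (2 * m) * (x\<^sup>2 - z\<^sup>2) - (z * ((x - z) / m) - z\<^sup>2 / (2 * lam))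
    = (\<theta> * x - z)\<^sup>2 / (2 * m * \<theta>)"
proof -
  have m: "m = lam * (1 - \<theta>)\<^sup>2 / \<theta>" using assms by (simp add: field_simps)
  have "1 - \<theta> \<noteq> 0" using assms by auto
  then show ?thesis using assms(1-3) unfolding m
    by (simp add: divide_simps) (simp add: power2_eq_square algebra_simps)
qed

text \<open>The rectangle of height \<open>z\<close> loses a triangle of area
  \<open>z^2 / (2 * lam)\<close> to the left of the kink \<open>p\<close>.\<close>

lemma integral_min_linear:
  fixes lam z :: real
  assumes "0 < lam" "a \<le> b" "0 \<le> z" "z \<le> lam * (b - a)"
  shows "((\<lambda>s. min (lam * (s - a)) z) has_integral z * (b - a) - z\<^sup>2 / (2 * lam)) {a..b}"
proof -
  define p where "p = a + z / lam"
  have p: "a \<le> p" "p \<le> b" using assms by (auto simp: p_def field_simps)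
  have "((\<lambda>s. lam * (s - a)) has_integral (lam * (p - a)\<^sup>2 / 2 - lam * (a - a)\<^sup>2 / 2)) {a..p}"
    by (rule fundamental_theorem_of_calculus[OF p(1)])
       (auto intro!: derivative_eq_intros simp: has_real_derivative_iff_has_vector_derivative[symmetric])
  then have 1: "((\<lambda>s. min (lam * (s - a)) z) has_integral (lam * (p - a)\<^sup>2 / 2)) {a..p}"
    by (rule has_integral_eq[rotated, THEN has_integral_eq_rhs]) (use assms in \<open>auto simp: p_def field_simps min_def\<close>)
  have "((\<lambda>s. z) has_integral z * (b - p)) {p..b}"
    using has_integral_const_real[of z p b] p by (simp add: mult.commute)
  then have 2: "((\<lambda>s. min (lam * (s - a)) z) has_integral z * (b - p)) {p..b}"
    by (rule has_integral_eq[rotated]) (use assms in \<open>auto simp: p_def field_simps min_def\<close>)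
  show ?thesis
    by (rule has_integral_eq_rhs[OF has_integral_combine[OF p 1 2]])
       (use assms in \<open>simp add: p_def power2_eq_square field_simps\<close>)
qed

text \<open>The value \<open>r b\<close> is left open because a stage's right endpoint already
  belongs to the next stage; a spike at one point does not affect the integral.\<close>

lemma integral_step:
  fixes lam :: real
  assumes "a \<le> p" "p \<le> b" "\<And>s. a \<le> s \<Longrightarrow> s < p \<Longrightarrow> r s = lam" "\<And>s. p \<le> s \<Longrightarrow> s < b \<Longrightarrow> r s = 0"
    and t: "a \<le> t" "t \<le> b"
  shows "integral {a..t} r = lam * min (t - a) (p - a)"
proof -
  define q where "q = min t p"
  have q: "a \<le> q" "q \<le> t" using assms by (auto simp: q_def)
  have 1: "(r has_integral lam * (q - a)) {a..q}"
    using has_integral_const_real[of lam a q] q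
    by (intro has_integral_spike_finite[of "{q}", where g=r and f="\<lambda>_. lam"])
       (use assms in \<open>auto simp: q_def mult.commute\<close>)
  have 2: "(r has_integral 0) {q..t}"
    by (intro has_integral_spike_finite[of "{t}", where g=r and f="\<lambda>_. 0"])
       (use assms in \<open>auto simp: q_def min_def split: if_splits\<close>)
  show ?thesis
    using integral_unique[OF has_integral_combine[OF q 1 2]] by (simp add: q_def min_def)
qed

section \<open>Switching times and levels of an arbitrary admissible policy\<close>

locale polling =
  fixes lam mu x0 :: real and r :: "real \<Rightarrow> real"
  assumes lam_pos: "0 < lam" and lam_less: "lam < mu" and x0_pos: "0 < x0"
    and admissible: "admissible_policy lam r"
begin

abbreviation "T \<equiv> empty_time lam mu x0"
abbreviation "t \<equiv> switch_time lam mu x0 r"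
abbreviation "x \<equiv> switch_level lam mu x0 r"

lemma rate_bounds: "0 \<le> s \<Longrightarrow> 0 \<le> r s" "0 \<le> s \<Longrightarrow> r s \<le> lam"
  using admissible by (auto simp: admissible_policy_def)

lemma rate_integrable:
  assumes "0 \<le> a"
  shows "r integrable_on {a..b}"
proof (rule measurable_bounded_by_integrable_imp_integrable)
  show "r \<in> borel_measurable (lebesgue_on {a..b})"
    using admissible assms by (auto simp: admissible_policy_def intro: measurable_restrict_mono)
  show "(\<lambda>_. lam) integrable_on {a..b}" by (rule integrable_const_ivl)
qed (use rate_bounds assms in auto)

lemma routed_split:
  assumes "0 \<le> a" "a \<le> b" "b \<le> s"
  shows "integral {a..s} r = integral {a..b} r + integral {b..s} r"
  using Henstock_Kurzweil_Integration.integral_combine[OF assms(2,3) rate_integrable[OF assms(1)]] by simp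

lemma routed_nonneg: "0 \<le> a \<Longrightarrow> 0 \<le> integral {a..s} r"
  by (rule integral_nonneg[OF rate_integrable]) (auto intro: rate_bounds)

lemma routed_le:
  assumes "0 \<le> a" "a \<le> s"
  shows "integral {a..s} r \<le> lam * (s - a)"
proof -
  have "integral {a..s} r \<le> integral {a..s} (\<lambda>_. lam)"
    by (rule integral_le[OF rate_integrable integrable_const_ivl]) (use assms rate_bounds in auto)
  then show ?thesis using assms by (simp add: mult.commute)
qed

lemma routed_mono: "0 \<le> a \<Longrightarrow> a \<le> b \<Longrightarrow> b \<le> s \<Longrightarrow> integral {a..b} r \<le> integral {a..s} r"
  using routed_split[of a b s] routed_nonneg[of b s] by simp

text \<open>Separates the total content, which falls at rate \<open>mu - lam\<close> under every
  policy, from the amount routed away.\<close>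

lemma busy_content:
  assumes "0 \<le> a" "a \<le> s"
  shows "\<xi> + integral {a..s} (\<lambda>u. lam - r u) - mu * (s - a)
    = \<xi> - (mu - lam) * (s - a) - integral {a..s} r"
  using assms by (simp add: integral_diff[OF integrable_const_ivl rate_integrable] algebra_simps)

text \<open>The busy content is strictly decreasing: the routed amount never falls and the drift
  \<open>mu - lam\<close> is positive.\<close>

lemma emptying_unique:
  assumes "0 \<le> a" "a \<le> b" "a \<le> b'"
    and "\<xi> - (mu - lam) * (b - a) - integral {a..b} r = 0"
    and "\<xi> - (mu - lam) * (b' - a) - integral {a..b'} r = 0"
  shows "b = b'"
proof -
  have "c = c'" if "c \<le> c'" "a \<le> c" "a \<le> c'"
    and "\<xi> - (mu - lam) * (c - a) - integral {a..c} r = 0"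
    and "\<xi> - (mu - lam) * (c' - a) - integral {a..c'} r = 0" for c c'
  proof -
    have "integral {a..c} r \<le> integral {a..c'} r" using routed_mono assms(1) that by simp
    then have "(mu - lam) * (c' - a) \<le> (mu - lam) * (c - a)" using that by linarith
    then show ?thesis using lam_less that by simp
  qed
  from this[of b b'] this[of b' b] assms show ?thesis by (cases "b \<le> b'") auto
qed

lemma emptying_exists:
  assumes "0 \<le> a" "0 \<le> \<xi>"
  obtains b where "a \<le> b" "\<xi> - (mu - lam) * (b - a) - integral {a..b} r = 0"
proof -
  \<comment> \<open>At \<open>e\<close> the total content would be zero, so the busy content is
    nonpositive by then.\<close>
  define e where "e = a + \<xi> / (mu - lam)"
  have e: "a \<le> e" using assms lam_less by (simp add: e_def)
  have "\<exists>b\<ge>a. b \<le> e \<and> \<xi> - (mu - lam) * (b - a) - integral {a..b} r = 0"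
  proof (rule IVT2')
    show "\<xi> - (mu - lam) * (e - a) - integral {a..e} r \<le> 0"
      using lam_less routed_nonneg[OF assms(1), of e] by (simp add: e_def)
    show "continuous_on {a..e} (\<lambda>b. \<xi> - (mu - lam) * (b - a) - integral {a..b} r)"
      by (intro continuous_intros indefinite_integral_continuous_1 rate_integrable assms)
  qed (use assms e in auto)
  then show thesis using that by blast
qed

text \<open>By uniqueness every zero is the least one, which disposes of \<open>LEAST\<close>.
  Leaving \<open>b\<close> arbitrary lets guessed switching times of a concrete policy be verified
  later.\<close>

lemma switch_Suc:
  assumes "0 \<le> t k" "t k \<le> b" "x k - (mu - lam) * (b - t k) - integral {t k..b} r = 0"
  shows "t (Suc k) = b" "x (Suc k) = integral {t k..b} r"
proof -
  have "(LEAST s. t k \<le> s \<and> x k + integral {t k..s} (\<lambda>u. lam - r u) - mu * (s - t k) = 0) = b"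
  proof (rule Least_equality)
    show "b \<le> s" if "t k \<le> s \<and> x k + integral {t k..s} (\<lambda>u. lam - r u) - mu * (s - t k) = 0" for s
      using emptying_unique[of "t k" b s "x k"] that assms busy_content[of "t k" s "x k"] by auto
  qed (use assms busy_content[of "t k" b "x k"] in auto)
  then show "t (Suc k) = b" by (simp add: switch_time_def switch_level_def Let_def)
  then show "x (Suc k) = integral {t k..b} r"
    by (simp add: switch_time_def switch_level_def Let_def)
qed

lemma switch_0 [simp]: "t 0 = 0" "x 0 = x0"
  by (simp_all add: switch_time_def switch_level_def)

text \<open>When the server switches, the queue it leaves is empty, so \<open>x k\<close> is the
  total content. The three facts are proved together because the next switch exists only for
  nonnegative \<open>t k\<close> and \<open>x k\<close>.\<close>

lemma switch_basic: "0 \<le> t k \<and> 0 \<le> x k \<and> x k = x0 - (mu - lam) * t k"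
proof (induction k)
  case 0
  then show ?case using x0_pos by simp
next
  case (Suc k)
  obtain b where b: "t k \<le> b" "x k - (mu - lam) * (b - t k) - integral {t k..b} r = 0"
    using emptying_exists[of "t k" "x k"] Suc by blast
  from switch_Suc[of k b] b Suc show ?case using routed_nonneg[of "t k" b]
    by (auto simp: algebra_simps)
qed

lemmas t_nonneg = switch_basic[THEN conjunct1]
  and x_nonneg = switch_basic[THEN conjunct2, THEN conjunct1]
  and x_eq = switch_basic[THEN conjunct2, THEN conjunct2]

lemma switch_step: "t k \<le> t (Suc k)" "x (Suc k) = integral {t k..t (Suc k)} r"
proof -
  obtain b where b: "t k \<le> b" "x k - (mu - lam) * (b - t k) - integral {t k..b} r = 0"
    by (rule emptying_exists[OF t_nonneg x_nonneg])
  show "t k \<le> t (Suc k)" unfolding switch_Suc(1)[OF t_nonneg b] by (rule b(1))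
  show "x (Suc k) = integral {t k..t (Suc k)} r"
    unfolding switch_Suc(1)[OF t_nonneg b] by (rule switch_Suc(2)[OF t_nonneg b])
qed

lemma t_mono: "i \<le> j \<Longrightarrow> t i \<le> t j"
  using switch_step(1) by (rule lift_Suc_mono_le)

lemma stage_length: "t (Suc k) - t k = (x k - x (Suc k)) / (mu - lam)"
  using lam_less by (simp add: x_eq[of k] x_eq[of "Suc k"] field_simps)

lemma t_le_T: "t k \<le> T"
  using x_nonneg[of k] x_eq[of k] lam_less by (simp add: empty_time_def field_simps)

text \<open>At most \<open>lam\<close> times the stage length is routed, and that length is itself a
  multiple of \<open>x k - x (Suc k)\<close>. The resulting geometric decay forces
  \<open>t k\<close> to converge to \<open>T\<close>.\<close>

lemma x_Suc_le: "x (Suc k) \<le> lam / mu * x k"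
proof -
  have "x (Suc k) \<le> lam * (t (Suc k) - t k)"
    using routed_le[OF t_nonneg switch_step(1)] switch_step(2) by simp
  then show ?thesis unfolding stage_length using lam_pos lam_less by (simp add: field_simps)
qed

lemma x_le_power: "x k \<le> (lam / mu) ^ k * x0"
proof (induction k)
  case (Suc k)
  have "x (Suc k) \<le> lam / mu * x k" by (rule x_Suc_le)
  also have "\<dots> \<le> lam / mu * ((lam / mu) ^ k * x0)"
    using Suc lam_pos lam_less by (intro mult_left_mono) auto
  finally show ?case by simp
qed simp

lemma x_tendsto: "x \<longlonglongrightarrow> 0"
proof (rule tendsto_sandwich[of "\<lambda>_. 0"])
  show "(\<lambda>k. (lam / mu) ^ k * x0) \<longlonglongrightarrow> 0"
    using lam_pos lam_less by (intro tendsto_mult_left_zero LIMSEQ_power_zero) auto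
qed (use x_nonneg x_le_power in auto)

lemma t_tendsto: "t \<longlonglongrightarrow> T"
proof -
  have "(\<lambda>k. (x0 - x k) / (mu - lam)) \<longlonglongrightarrow> (x0 - 0) / (mu - lam)"
    using lam_less by (intro tendsto_intros x_tendsto) auto
  moreover have "(x0 - x k) / (mu - lam) = t k" for k
    using lam_less by (simp add: x_eq)
  ultimately show ?thesis by (simp add: empty_time_def)
qed

lemma stage_eq:
  assumes "t k \<le> s" "s < t (Suc k)"
  shows "stage lam mu x0 r s = k"
  unfolding stage_def
proof (rule the_equality)
  fix j assume "t j \<le> s \<and> s < t (Suc j)"
  then have "\<not> Suc j \<le> k" "\<not> Suc k \<le> j"
    using assms t_mono[of "Suc j" k] t_mono[of "Suc k" j] by linarith+
  then show "j = k" by simp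
qed (use assms in simp)

lemma stage_exists:
  assumes "0 \<le> s" "s < T"
  obtains k where "t k \<le> s" "s < t (Suc k)"
proof -
  \<comment> \<open>Convergence gives a switch after \<open>s\<close>. The first such index is not 0
    since \<open>t 0 = 0\<close>, and its predecessor is the stage.\<close>
  have "\<exists>n. s < t n"
    using order_tendstoD(1)[OF t_tendsto assms(2)] by (auto dest: eventually_happens)
  then have n: "s < t (LEAST n. s < t n)" by (rule LeastI_ex)
  then obtain k where k: "(LEAST n. s < t n) = Suc k"
    using assms(1) by (cases "LEAST n. s < t n") auto
  have "\<not> s < t k" by (rule not_less_Least) (simp only: k lessI)
  moreover have "s < t (Suc k)" using n by (simp only: k)
  ultimately show thesis by (intro that[of k]) auto
qed

section \<open>The integral of the idle content and the cost\<close>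

lemma idle_eq:
  assumes "t k \<le> s" "s < t (Suc k)"
  shows "idle lam mu x0 r s = integral {t k..s} r"
  using stage_eq[OF assms] assms t_le_T[of "Suc k"] by (simp add: idle_def)

lemma busy_idle_eq:
  assumes "t k \<le> s" "s < t (Suc k)"
  shows "busy lam mu x0 r s = x k - (mu - lam) * (s - t k) - idle lam mu x0 r s"
  using stage_eq[OF assms] assms t_le_T[of "Suc k"] busy_content[OF t_nonneg assms(1)]
  by (simp add: busy_def idle_eq[OF assms] Let_def)

lemma content:
  assumes "0 \<le> s" "s \<le> T"
  shows "busy lam mu x0 r s = x0 - (mu - lam) * s - idle lam mu x0 r s"
proof (cases "s < T")
  case True
  then obtain k where k: "t k \<le> s" "s < t (Suc k)" using stage_exists assms by blast
  show ?thesis using x_eq[of k] by (simp add: busy_idle_eq[OF k] algebra_simps)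
next
  \<comment> \<open>At \<open>T\<close> itself \<open>busy\<close> and \<open>idle\<close> have the
    default value 0, which agrees with the vanishing total content.\<close>
  case False
  then show ?thesis using assms lam_less by (auto simp: busy_def idle_def empty_time_def)
qed

lemma idle_bounds:
  assumes "t k \<le> s" "s < t (Suc k)"
  shows "0 \<le> idle lam mu x0 r s" "idle lam mu x0 r s \<le> min (lam * (s - t k)) (x (Suc k))"
  using routed_nonneg[OF t_nonneg, of k s] routed_le[OF t_nonneg assms(1)]
    routed_mono[OF t_nonneg assms(1), of "t (Suc k)"] assms(2)
  by (auto simp: idle_eq[OF assms] switch_step(2)[of k])

text \<open>Supplies the constant bound for dominated convergence.\<close>

lemma idle_abs_le:
  assumes "0 \<le> s" "s \<le> T"
  shows "norm (idle lam mu x0 r s) \<le> x0"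
proof (cases "s < T")
  case True
  then obtain k where k: "t k \<le> s" "s < t (Suc k)" using stage_exists assms by blast
  have "x (Suc k) \<le> x0" using x_eq[of "Suc k"] t_nonneg[of "Suc k"] lam_less by simp
  then show ?thesis using idle_bounds[OF k] by simp
qed (use x0_pos in \<open>simp add: idle_def\<close>)

lemma idle_integrable_stage: "idle lam mu x0 r integrable_on {t k..t (Suc k)}"
proof (rule integrable_spike_finite[of "{t (Suc k)}"])
  show "(\<lambda>s. integral {t k..s} r) integrable_on {t k..t (Suc k)}"
    by (intro integrable_continuous_real indefinite_integral_continuous_1 rate_integrable t_nonneg)
qed (use idle_eq in auto)

lemma min_integral_stage:
  "((\<lambda>s. min (lam * (s - t k)) (x (Suc k))) has_integral
    x (Suc k) * ((x k - x (Suc k)) / (mu - lam)) - (x (Suc k))\<^sup>2 / (2 * lam)) {t k..t (Suc k)}"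
  unfolding stage_length[symmetric]
proof (rule integral_min_linear[OF lam_pos switch_step(1) x_nonneg])
  show "x (Suc k) \<le> lam * (t (Suc k) - t k)"
    unfolding switch_step(2) by (rule routed_le[OF t_nonneg switch_step(1)])
qed

lemma idle_integral_stage_le:
  "integral {t k..t (Suc k)} (idle lam mu x0 r)
    \<le> x (Suc k) * ((x k - x (Suc k)) / (mu - lam)) - (x (Suc k))\<^sup>2 / (2 * lam)"
proof -
  \<comment> \<open>\<open>idle_bounds\<close> is silent at the right endpoint, so the majorant is
    redefined there as \<open>idle\<close> itself.\<close>
  have "integral {t k..t (Suc k)} (idle lam mu x0 r)
    \<le> integral {t k..t (Suc k)} (\<lambda>s. if s = t (Suc k) then idle lam mu x0 r s else min (lam * (s - t k)) (x (Suc k)))"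
  proof (rule integral_le[OF idle_integrable_stage])
    show "(\<lambda>s. if s = t (Suc k) then idle lam mu x0 r s else min (lam * (s - t k)) (x (Suc k)))
        integrable_on {t k..t (Suc k)}"
      using min_integral_stage by (intro integrable_spike_finite[OF _ _ has_integral_integrable[OF min_integral_stage], of "{t (Suc k)}"]) auto
  qed (use idle_bounds in auto)
  also have "\<dots> = integral {t k..t (Suc k)} (\<lambda>s. min (lam * (s - t k)) (x (Suc k)))"
    by (rule integral_spike[of "{t (Suc k)}"]) auto
  finally show ?thesis unfolding integral_unique[OF min_integral_stage] .
qed

lemma idle_integrable_upto: "idle lam mu x0 r integrable_on {0..t k}"
proof (induction k)
  case (Suc k)
  show ?case
    by (rule Henstock_Kurzweil_Integration.integrable_combine[OF t_nonneg switch_step(1) Suc idle_integrable_stage])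
qed (use integrable_on_refl[of "idle lam mu x0 r" 0] in simp)

lemma idle_integral_upto_Suc:
  "integral {0..t (Suc k)} (idle lam mu x0 r)
    = integral {0..t k} (idle lam mu x0 r) + integral {t k..t (Suc k)} (idle lam mu x0 r)"
  using Henstock_Kurzweil_Integration.integral_combine[OF t_nonneg switch_step(1) idle_integrable_upto] by simp

text \<open>Finitely many stages need not reach \<open>T\<close>, so \<open>idle\<close> is cut off
  after \<open>t k\<close> and dominated convergence is applied.\<close>

lemma idle_integral_limit:
  "idle lam mu x0 r integrable_on {0..T}"
  "(\<lambda>k. integral {0..t k} (idle lam mu x0 r)) \<longlonglongrightarrow> integral {0..T} (idle lam mu x0 r)"
proof -
  let ?f = "\<lambda>k s. if s \<in> {0..t k} then idle lam mu x0 r s else 0"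
  have 1: "?f k integrable_on {0..T}" for k
    using idle_integrable_upto[of k] t_le_T[of k]
    by (subst integrable_restrict_Int) (simp add: Int_absorb1 Int_absorb2)
  have 2: "(\<lambda>k. ?f k s) \<longlonglongrightarrow> idle lam mu x0 r s" if s: "s \<in> {0..T}" for s
  proof (cases "s < T")
    case True
    have "\<forall>\<^sub>F k in sequentially. s < t k" by (rule order_tendstoD(1)[OF t_tendsto True])
    then have "\<forall>\<^sub>F k in sequentially. ?f k s = idle lam mu x0 r s"
      by eventually_elim (use s in auto)
    then show ?thesis by (rule tendsto_eventually)
  next
    \<comment> \<open>Whether or not some \<open>t k\<close> equals \<open>T\<close>, the cut-off
      function and \<open>idle\<close> are both 0 there.\<close>
    case False
    then have "idle lam mu x0 r s = 0" by (simp add: idle_def)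
    then show ?thesis by (simp only: if_cancel tendsto_const)
  qed
  have 3: "norm (?f k s) \<le> x0" if "s \<in> {0..T}" for k s
    using idle_abs_le[of s] that x0_pos by auto
  have eq: "integral {0..T} (?f k) = integral {0..t k} (idle lam mu x0 r)" for k
    using t_le_T[of k] by (subst integral_restrict_Int) (simp add: Int_absorb1 Int_absorb2)
  show "idle lam mu x0 r integrable_on {0..T}"
    by (rule dominated_convergence(1)[of ?f _ "\<lambda>_. x0", OF 1 integrable_const_ivl 3 2])
  show "(\<lambda>k. integral {0..t k} (idle lam mu x0 r)) \<longlonglongrightarrow> integral {0..T} (idle lam mu x0 r)"
    using dominated_convergence(2)[of ?f _ "\<lambda>_. x0", OF 1 integrable_const_ivl 3 2] by (simp only: eq)
qed

lemma total_cost_eq: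
  "total_cost lam mu x0 c d r
    = integral {0..T} (\<lambda>s. c * (x0 - (mu - lam) * s)) - (c - d) * integral {0..T} (idle lam mu x0 r)"
proof -
  have "total_cost lam mu x0 c d r
      = integral {0..T} (\<lambda>s. c * (x0 - (mu - lam) * s) - (c - d) * idle lam mu x0 r s)"
    unfolding total_cost_def by (rule integral_cong) (simp add: content algebra_simps)
  also have "\<dots> = integral {0..T} (\<lambda>s. c * (x0 - (mu - lam) * s))
      - integral {0..T} (\<lambda>s. (c - d) * idle lam mu x0 r s)"
    by (intro integral_diff integrable_continuous_real continuous_intros
        integrable_on_mult_right idle_integral_limit)
  finally show ?thesis by simp
qed

section \<open>The upper bound on the idle integral and its attainment\<close>

context
  fixes \<theta> :: real
  assumes \<theta>: "0 < \<theta>" "\<theta> < 1" "lam * (1 - \<theta>)\<^sup>2 = (mu - lam) * \<theta>"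
begin

text \<open>The square in \<open>stage_reward_identity\<close> is nonnegative, so the stage bounds
  telescope; the remainder vanishes as \<open>x k\<close> tends to 0.\<close>

lemma idle_integral_le: "integral {0..T} (idle lam mu x0 r) \<le> \<theta> / (2 * (mu - lam)) * x0\<^sup>2"
proof -
  have "integral {0..t k} (idle lam mu x0 r) \<le> \<theta> / (2 * (mu - lam)) * (x0\<^sup>2 - (x k)\<^sup>2)" for k
  proof (induction k)
    case (Suc k)
    have "x (Suc k) * ((x k - x (Suc k)) / (mu - lam)) - (x (Suc k))\<^sup>2 / (2 * lam)
        \<le> \<theta> / (2 * (mu - lam)) * ((x k)\<^sup>2 - (x (Suc k))\<^sup>2)"
    proof -
      have "0 \<le> (\<theta> * x k - x (Suc k))\<^sup>2 / (2 * (mu - lam) * \<theta>)" using lam_less \<theta> by simp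
      then show ?thesis
        using stage_reward_identity[of lam "mu - lam" \<theta> "x k" "x (Suc k)"] lam_pos lam_less \<theta> by linarith
    qed
    then show ?case using Suc idle_integral_stage_le[of k]
      unfolding idle_integral_upto_Suc by (simp add: right_diff_distrib)
  qed simp
  moreover have "(\<lambda>k. \<theta> / (2 * (mu - lam)) * (x0\<^sup>2 - (x k)\<^sup>2)) \<longlonglongrightarrow> \<theta> / (2 * (mu - lam)) * (x0\<^sup>2 - 0\<^sup>2)"
    by (intro tendsto_intros x_tendsto)
  ultimately have "integral {0..T} (idle lam mu x0 r) \<le> \<theta> / (2 * (mu - lam)) * (x0\<^sup>2 - 0\<^sup>2)"
    by (intro LIMSEQ_le[OF idle_integral_limit(2)]) blast+
  then show ?thesis by simp
qed

text \<open>If a stage starts at level \<open>\<xi>\<close> and everything goes to the idle queue,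
  that queue holds \<open>\<theta> * \<xi>\<close> after time \<open>\<theta> * \<xi> / lam\<close>.
  At this moment the busy queue holds \<open>\<theta> * (1 - \<theta>) * \<xi>\<close>, so the
  threshold is met exactly at the optimal level.\<close>

lemma threshold_gap:
  "1 / (1 - \<theta>) * (\<xi> - (mu - lam) * (\<theta> * \<xi> / lam) - \<theta> * \<xi>) = \<theta> * \<xi>"
proof -
  have "(mu - lam) * (\<theta> * \<xi> / lam) = (1 - \<theta>)\<^sup>2 * \<xi>"
  proof -
    have "(mu - lam) * (\<theta> * \<xi> / lam) = ((mu - lam) * \<theta>) * \<xi> / lam" by simp
    also have "\<dots> = (1 - \<theta>)\<^sup>2 * \<xi>" unfolding \<theta>(3)[symmetric] using lam_pos by simp
    finally show ?thesis .
  qed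
  then show ?thesis using \<theta> by (simp add: field_simps power2_eq_square)
qed

text \<open>The gap \<open>h\<close> between threshold times busy content and idle content is
  strictly decreasing. Hence the rule routes to the idle queue up to one crossing time
  \<open>p\<close> and to the busy queue from then on.\<close>

lemma threshold_stage:
  assumes rule: "follows_threshold_rule lam mu x0 (1 / (1 - \<theta>)) r" and pos: "0 < x k"
  shows "x (Suc k) = \<theta> * x k"
    and "\<And>s. t k \<le> s \<Longrightarrow> s \<le> t (Suc k) \<Longrightarrow> integral {t k..s} r = min (lam * (s - t k)) (x (Suc k))"
proof -
  \<comment> \<open>The stage formulas replace \<open>idle\<close> and \<open>busy\<close> to keep
    \<open>h\<close> continuous up to \<open>t (Suc k)\<close>, where those functions have left the
    stage.\<close>
  define Y where "Y s = integral {t k..s} r" for s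
  define h where "h s = 1 / (1 - \<theta>) * (x k - (mu - lam) * (s - t k) - Y s) - Y s" for s
  have "\<exists>p\<ge>t k. p \<le> t (Suc k) \<and> h p = 0"
  proof (rule IVT2')
    have "x k - (mu - lam) * (t (Suc k) - t k) - Y (t (Suc k)) = 0"
      using lam_less by (simp add: stage_length Y_def switch_step(2)[symmetric])
    then show "h (t (Suc k)) \<le> 0"
      using x_nonneg[of "Suc k"] switch_step(2)[of k] by (simp add: h_def Y_def)
    show "0 \<le> h (t k)" using pos \<theta> by (simp add: h_def Y_def)
    show "continuous_on {t k..t (Suc k)} h"
      unfolding h_def Y_def using \<theta>
      by (intro continuous_intros indefinite_integral_continuous_1 rate_integrable t_nonneg)
  qed (rule switch_step(1))
  then obtain p where p: "t k \<le> p" "p \<le> t (Suc k)" "h p = 0" by blast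
  have h_less: "h s' < h s" if "t k \<le> s" "s < s'" for s s'
  proof -
    have "Y s \<le> Y s'" unfolding Y_def using routed_mono[OF t_nonneg, of k s s'] that by simp
    moreover have "(mu - lam) * (s - t k) < (mu - lam) * (s' - t k)" using that lam_less by simp
    ultimately have "x k - (mu - lam) * (s' - t k) - Y s' < x k - (mu - lam) * (s - t k) - Y s" by linarith
    then have "1 / (1 - \<theta>) * (x k - (mu - lam) * (s' - t k) - Y s') < 1 / (1 - \<theta>) * (x k - (mu - lam) * (s - t k) - Y s)"
      using \<theta> by (intro mult_strict_left_mono) auto
    then show ?thesis using \<open>Y s \<le> Y s'\<close> unfolding h_def by linarith
  qed
  have r_eq: "r s = (if 0 < h s then lam else 0)" if "t k \<le> s" "s < t (Suc k)" for s
  proof -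
    have "0 \<le> s" "s < T" using that t_nonneg[of k] t_le_T[of "Suc k"] by auto
    then show ?thesis using rule that
      by (simp add: follows_threshold_rule_def busy_idle_eq[OF that] idle_eq[OF that] h_def Y_def)
  qed
  have Y_eq: "Y s = lam * min (s - t k) (p - t k)" if "t k \<le> s" "s \<le> t (Suc k)" for s
    unfolding Y_def
  proof (rule integral_step[OF p(1,2) _ _ that])
    show "r s = lam" if "t k \<le> s" "s < p" for s using r_eq[of s] h_less[of s p] p that by simp
    show "r s = 0" if "p \<le> s" "s < t (Suc k)" for s using r_eq[of s] h_less[of p s] p that by (cases "s = p") auto
  qed
  \<comment> \<open>The crossing time predicted by \<open>threshold_gap\<close>.\<close>
  define q where "q = t k + \<theta> * x k / lam"
  have hq: "1 / (1 - \<theta>) * (x k - (mu - lam) * (q - t k) - lam * (q - t k)) = lam * (q - t k)"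
    using threshold_gap[of "x k"] lam_pos by (simp add: q_def)
  have "1 / (1 - \<theta>) * (x k - (mu - lam) * (p - t k) - lam * (p - t k)) = lam * (p - t k)"
    using p Y_eq[of p] by (simp add: h_def)
  \<comment> \<open>Both \<open>p\<close> and \<open>q\<close> solve one linear equation, whose
    slope is nonzero.\<close>
  with hq have "(1 / (1 - \<theta>) * mu + lam) * (p - q) = 0"
    unfolding right_diff_distrib distrib_right left_diff_distrib by (simp add: mult_ac)
  moreover have "0 < 1 / (1 - \<theta>) * mu + lam" using \<theta> lam_pos lam_less by (intro add_pos_pos mult_pos_pos) auto
  ultimately have "p = q" by simp
  then have Yp: "lam * (p - t k) = \<theta> * x k" using lam_pos by (simp add: q_def)
  then show *: "x (Suc k) = \<theta> * x k" 
    using Y_eq[OF switch_step(1) order_refl] p by (simp add: Y_def switch_step(2)[symmetric] min_absorb2)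
  show "integral {t k..s} r = min (lam * (s - t k)) (x (Suc k))" if "t k \<le> s" "s \<le> t (Suc k)" for s
    using Y_eq[OF that] lam_pos unfolding * Yp[symmetric] by (simp add: Y_def min_mult_distrib_left)
qed

text \<open>The idle content equals its pointwise bound inside each stage, and
  \<open>x (Suc k) = \<theta> * x k\<close> makes the square vanish, so nothing is lost in the
  telescoping.\<close>

lemma threshold_idle_integral:
  assumes rule: "follows_threshold_rule lam mu x0 (1 / (1 - \<theta>)) r"
  shows "integral {0..T} (idle lam mu x0 r) = \<theta> / (2 * (mu - lam)) * x0\<^sup>2"
proof -
  have pos: "0 < x k" for k
    by (induction k) (use x0_pos \<theta> threshold_stage(1)[OF rule] in auto)
  have "integral {0..t k} (idle lam mu x0 r) = \<theta> / (2 * (mu - lam)) * (x0\<^sup>2 - (x k)\<^sup>2)" for k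
  proof (induction k)
    case (Suc k)
    have "integral {t k..t (Suc k)} (idle lam mu x0 r)
        = integral {t k..t (Suc k)} (\<lambda>s. min (lam * (s - t k)) (x (Suc k)))"
      by (rule integral_spike[of "{t (Suc k)}"]) (use idle_eq threshold_stage(2)[OF rule pos] in auto)
    also have "\<dots> = x (Suc k) * ((x k - x (Suc k)) / (mu - lam)) - (x (Suc k))\<^sup>2 / (2 * lam)"
      using min_integral_stage by (rule integral_unique)
    also have "\<dots> = \<theta> / (2 * (mu - lam)) * ((x k)\<^sup>2 - (x (Suc k))\<^sup>2)"
      using stage_reward_identity[of lam "mu - lam" \<theta> "x k" "x (Suc k)"] lam_pos lam_less \<theta>
      by (simp add: threshold_stage(1)[OF rule pos])
    finally show ?case using Suc unfolding idle_integral_upto_Suc by (simp add: right_diff_distrib)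
  qed simp
  then have "(\<lambda>k. integral {0..t k} (idle lam mu x0 r)) \<longlonglongrightarrow> \<theta> / (2 * (mu - lam)) * (x0\<^sup>2 - 0\<^sup>2)"
    by (simp only:) (intro tendsto_intros x_tendsto)
  with idle_integral_limit(2) show ?thesis by (simp add: LIMSEQ_unique)
qed

end

end

section \<open>Construction of a policy that obeys the rule\<close>

text \<open>The rule refers to the state that \<open>r\<close> generates, so \<open>r\<close> is
  written down as an explicit function of time and its state is computed afterwards.\<close>

lemma threshold_policy_exists:
  fixes lam mu x0 \<theta> :: real
  assumes lam: "0 < lam" "lam < mu" and x0: "0 < x0"
    and \<theta>: "0 < \<theta>" "\<theta> < 1" "lam * (1 - \<theta>)\<^sup>2 = (mu - lam) * \<theta>"
  shows "\<exists>r. admissible_policy lam r \<and> follows_threshold_rule lam mu x0 (1 / (1 - \<theta>)) r"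
proof -
  \<comment> \<open>The total content falls to \<open>\<theta> ^ k * x0\<close> at
    \<open>\<tau> k\<close>; by \<open>p k\<close> the idle queue has received
    \<open>\<theta>\<close> times that amount at rate \<open>lam\<close>.\<close>
  define \<tau> where "\<tau> k = x0 * (1 - \<theta> ^ k) / (mu - lam)" for k :: nat
  define p where "p k = \<tau> k + \<theta> * (\<theta> ^ k * x0) / lam" for k
  define r where "r s = (if \<exists>k. \<tau> k \<le> s \<and> s < p k then lam else 0)" for s
  have \<tau>_mono: "\<tau> i \<le> \<tau> j" if "i \<le> j" for i j
    using power_decreasing[OF that, of \<theta>] \<theta> lam x0
    unfolding \<tau>_def by (intro divide_right_mono mult_left_mono) auto
  have \<tau>_Suc: "\<tau> (Suc k) = \<tau> k + (1 - \<theta>) / (mu - lam) * (\<theta> ^ k * x0)" for k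
    by (simp add: \<tau>_def add_divide_distrib[symmetric] algebra_simps)
  have p1: "\<tau> k < p k" for k using \<theta> lam x0 by (simp add: p_def)
  have p2: "p k \<le> \<tau> (Suc k)" for k
  proof -
    have "\<theta> / lam = (1 - \<theta>)\<^sup>2 / (mu - lam)" using \<theta>(3) lam by (simp add: field_simps)
    also have "\<dots> \<le> (1 - \<theta>) / (mu - lam)"
      using \<theta> lam by (intro divide_right_mono) (auto simp: power2_eq_square mult_left_le)
    finally have "\<theta> / lam * (\<theta> ^ k * x0) \<le> (1 - \<theta>) / (mu - lam) * (\<theta> ^ k * x0)"
      using \<theta> x0 by (intro mult_right_mono) auto
    then show ?thesis by (simp add: p_def \<tau>_Suc)
  qed
  have r_idle: "r s = lam" if "\<tau> k \<le> s" "s < p k" for k s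
    using that by (auto simp: r_def)
  have r_busy: "r s = 0" if "p k \<le> s" "s < \<tau> (Suc k)" for k s
  proof -
    \<comment> \<open>Earlier filling intervals end by \<open>\<tau> k\<close>, later ones start no
      sooner than \<open>\<tau> (Suc k)\<close>.\<close>
    have "\<not> (\<tau> j \<le> s \<and> s < p j)" for j
    proof (cases j k rule: linorder_cases)
      case less
      then show ?thesis using p1[of k] p2[of j] \<tau>_mono[of "Suc j" k] that by auto
    next
      case greater
      then show ?thesis using \<tau>_mono[of "Suc k" j] that by auto
    qed (use that in auto)
    then show ?thesis by (auto simp: r_def)
  qed
  have "{s. \<exists>k. \<tau> k \<le> s \<and> s < p k} = (\<Union>k. {\<tau> k..<p k})" by auto
  then have "{s. \<exists>k. \<tau> k \<le> s \<and> s < p k} \<in> sets borel" by simp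
  then have "r \<in> borel_measurable borel"
    unfolding r_def by (intro measurable_If) (auto simp: pred_def)
  then have "r \<in> borel_measurable (lebesgue_on {0..})"
    by (intro measurable_restrict_space1 measurable_completion) simp
  then have adm: "admissible_policy lam r" using lam by (simp add: admissible_policy_def r_def)
  then interpret polling lam mu x0 r using lam x0 by unfold_locales
  have Y: "integral {\<tau> k..s} r = lam * min (s - \<tau> k) (p k - \<tau> k)"
    if "\<tau> k \<le> s" "s \<le> \<tau> (Suc k)" for k s
    by (rule integral_step[OF less_imp_le[OF p1] p2 _ _ that]) (blast intro: r_idle r_busy)+
  have switch: "t k = \<tau> k \<and> x k = \<theta> ^ k * x0" for k
  proof (induction k)
    case 0
    then show ?case by (simp add: \<tau>_def)
  next
    case (Suc k)
    have le: "\<tau> k \<le> \<tau> (Suc k)" by (rule \<tau>_mono) simp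
    have "integral {\<tau> k..\<tau> (Suc k)} r = \<theta> ^ Suc k * x0"
      unfolding Y[OF le order_refl] using p1[of k] p2[of k] lam by (simp add: min_absorb2 p_def)
    moreover have "(mu - lam) * (\<tau> (Suc k) - \<tau> k) = (1 - \<theta>) * (\<theta> ^ k * x0)"
      using lam by (simp add: \<tau>_Suc)
    then have "\<theta> ^ k * x0 - (mu - lam) * (\<tau> (Suc k) - \<tau> k) - \<theta> ^ Suc k * x0 = 0"
      by (simp add: left_diff_distrib mult.assoc)
    ultimately show ?case using switch_Suc[of k "\<tau> (Suc k)"] Suc le t_nonneg[of k] by simp
  qed
  have "r s = (if idle lam mu x0 r s < 1 / (1 - \<theta>) * busy lam mu x0 r s then lam else 0)"
    if s: "0 \<le> s" "s < T" for s
  proof -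
    obtain k where k: "t k \<le> s" "s < t (Suc k)" using stage_exists s by blast
    then have k': "\<tau> k \<le> s" "s < \<tau> (Suc k)" by (simp_all add: switch)
    define y where "y = lam * min (s - \<tau> k) (p k - \<tau> k)"
    have idle: "idle lam mu x0 r s = y" using Y[of k s] k' idle_eq[OF k] by (simp add: switch y_def)
    have busy: "busy lam mu x0 r s = \<theta> ^ k * x0 - (mu - lam) * (s - \<tau> k) - y"
      using busy_idle_eq[OF k] idle by (simp add: switch)
    define z where "z = lam * (p k - \<tau> k)"
    have "z = \<theta> * (\<theta> ^ k * x0)" "p k - \<tau> k = \<theta> * (\<theta> ^ k * x0) / lam"
      using lam by (simp_all add: z_def p_def)
    then have gap: "1 / (1 - \<theta>) * (\<theta> ^ k * x0 - (mu - lam) * (p k - \<tau> k) - z) = z"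
      using threshold_gap[OF \<theta>, of "\<theta> ^ k * x0"] by simp
    have pos: "0 < 1 / (1 - \<theta>)" using \<theta> by simp
    \<comment> \<open>Equality holds at \<open>p k\<close> by \<open>gap\<close>. Before it
      \<open>y\<close> is smaller and the total content larger; after it \<open>y\<close> stays at
      \<open>z\<close> while the total content falls.\<close>
    show ?thesis
    proof (cases "s < p k")
      case True
      have "y < z" using True lam by (simp add: y_def z_def)
      moreover have "(mu - lam) * (s - \<tau> k) < (mu - lam) * (p k - \<tau> k)" using True lam by simp
      ultimately have "1 / (1 - \<theta>) * (\<theta> ^ k * x0 - (mu - lam) * (p k - \<tau> k) - z)
          < 1 / (1 - \<theta>) * (\<theta> ^ k * x0 - (mu - lam) * (s - \<tau> k) - y)"
        by (intro mult_strict_left_mono[OF _ pos]) linarith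
      with gap \<open>y < z\<close> show ?thesis unfolding idle busy using r_idle[OF k'(1) True] by simp
    next
      case False
      then have "y = z" by (simp add: y_def z_def min_def)
      moreover have "(mu - lam) * (p k - \<tau> k) \<le> (mu - lam) * (s - \<tau> k)" using False lam by simp
      ultimately have "1 / (1 - \<theta>) * (\<theta> ^ k * x0 - (mu - lam) * (s - \<tau> k) - y)
          \<le> 1 / (1 - \<theta>) * (\<theta> ^ k * x0 - (mu - lam) * (p k - \<tau> k) - z)"
        using pos by (intro mult_left_mono) linarith+
      with gap \<open>y = z\<close> show ?thesis unfolding idle busy using r_busy[OF _ k'(2)] False by simp
    qed
  qed
  then have "follows_threshold_rule lam mu x0 (1 / (1 - \<theta>)) r"
    unfolding follows_threshold_rule_def by blast
  with adm show ?thesis by blast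
qed

section \<open>Comparison of the rule with an arbitrary policy\<close>

text \<open>The existence conjunct keeps the optimality conjunct from being vacuous.\<close>

theorem theorem6p4:
  fixes lam mu x0 c d :: real
  assumes "0 < lam" "lam < mu" "0 < x0" "d < c"
  shows "(\<exists>r. admissible_policy lam r \<and>
              follows_threshold_rule lam mu x0 (threshold (lam / mu)) r) \<and>
         (\<forall>r. admissible_policy lam r \<and>
              follows_threshold_rule lam mu x0 (threshold (lam / mu)) r \<longrightarrow>
              optimal_policy lam mu x0 c d r)"
proof -
  obtain \<theta> where \<theta>: "0 < \<theta>" "\<theta> < 1" "lam * (1 - \<theta>)\<^sup>2 = (mu - lam) * \<theta>"
    and thr: "threshold (lam / mu) = 1 / (1 - \<theta>)"
    using threshold_contraction assms(1,2) by blast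
  have "total_cost lam mu x0 c d r \<le> total_cost lam mu x0 c d r'"
    if "admissible_policy lam r" "follows_threshold_rule lam mu x0 (1 / (1 - \<theta>)) r"
      "admissible_policy lam r'" for r r'
  proof -
    interpret r: polling lam mu x0 r using assms that by unfold_locales
    interpret r': polling lam mu x0 r' using assms that by unfold_locales
    have "integral {0..r'.T} (idle lam mu x0 r') \<le> integral {0..r'.T} (idle lam mu x0 r)"
      using r'.idle_integral_le[OF \<theta>] r.threshold_idle_integral[OF \<theta> that(2)] by linarith
    then show ?thesis unfolding r.total_cost_eq r'.total_cost_eq
      using assms(4) by (intro diff_left_mono mult_left_mono) auto
  qed
  then show ?thesis
    using threshold_policy_exists[OF assms(1-3) \<theta>] unfolding thr optimal_policy_def by blast
qed

end
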